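(* The variance $V:\mathcal X\to[0,\infty]$ is monotone, lower semicontinuous with respect to the box topology, and $2$-homogeneous.
   Context: A pm-space is a triple $X=(X,d_X,m_X)$ with $(X,d_X)$ a complete separable metric space and $m_X$ a Borel probability measure. Two pm-spaces are isomorphic if there is an isometry $\operatorname{supp} m_X\to\operatorname{supp} m_Y$ pushing $m_X$ forward to $m_Y$; $\mathcal X$ is the set of isomorphism classes, and a class is always represented by a space with $\operatorname{supp}m_X=X$. Lipschitz order: $Y\prec X$ iff there is a $1$-Lipschitz map $\phi:X\to Y$ with $\phi_\#m_X=m_Y$. Box distance: a parameter of $X$ is a Borel map $a:[0,1]\to X$ with $a_\#\mathcal L^1=m_X$; $\square(X,Y)$ is the infimum of $\epsilon>0$ such that there are parameters $a$ of $X$, $b$ of $Y$ and a Borel set $I_0\subset[0,1]$ with $\mathcal L^1(I_0)\ge1-\epsilon$ and $|d_X(a(s),a(t))-d_Y(b(s),b(t))|\le\epsilon$ for all $s,t\in I_0$; it induces the box topology on $\mathcal X$. $V(X)=\sup_fV_X(f)$, the supremum over all $1$-Lipschitz $f:X\to\mathbb R$, where $V_X(f)=\frac12\int_{X\times X}(f(x)-f(y))^2\,dm_X^{\otimes2}(x,y)$. $F:\mathcal X\to[0,\infty]$ is monotone if $X\prec Y$ implies $F(X)\le F(Y)$, and $d$-homogeneous if $F(tX)=t^dF(X)$ for all $t>0$, where $tX=(X,td_X,m_X)$. *)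

theory Defs
  imports "HOL-Probability.Probability_Measure"
begin

subsection \<open>pm-spaces, supports and isomorphism\<close>

text \<open>The carrier is \<open>mspace d\<close>, an arbitrary subset of the ambient type, and the topology is the
  one of \<open>d\<close>; it is unrelated to any topology that \<open>'a\<close> may carry.\<close>

type_synonym 'a pm = "'a metric \<times> 'a measure"

definition pm_space :: "'a pm \<Rightarrow> bool" where
  "pm_space X \<longleftrightarrow> (case X of (d, m) \<Rightarrow>
     mcomplete_of d \<and> separable_space (mtopology_of d) \<and>
     prob_space m \<and> space m = mspace d \<and>
     sets m = sigma_sets (mspace d) {U. openin (mtopology_of d) U})"

definition pm_supp :: "'a pm \<Rightarrow> 'a set" where
  "pm_supp X = (case X of (d, m) \<Rightarrow>
     {x \<in> mspace d. \<forall>U. openin (mtopology_of d) U \<and> x \<in> U \<longrightarrow> 0 < emeasure m U})"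

text \<open>An isometry maps onto its target; its values outside the support are irrelevant.\<close>

definition pm_isometry :: "'a pm \<Rightarrow> 'b pm \<Rightarrow> ('a \<Rightarrow> 'b) \<Rightarrow> bool" where
  "pm_isometry X Y \<phi> \<longleftrightarrow>
     \<phi> ` pm_supp X = pm_supp Y \<and>
     (\<forall>x \<in> pm_supp X. \<forall>y \<in> pm_supp X. mdist (fst Y) (\<phi> x) (\<phi> y) = mdist (fst X) x y) \<and>
     distr (restrict_space (snd X) (pm_supp X)) (snd Y) \<phi> = snd Y"

definition pm_iso :: "'a pm \<Rightarrow> 'b pm \<Rightarrow> bool" where
  "pm_iso X Y \<longleftrightarrow> (\<exists>\<phi>. pm_isometry X Y \<phi>)"

definition full_pm_space :: "'a pm \<Rightarrow> bool" where
  "full_pm_space X \<longleftrightarrow> pm_space X \<and> pm_supp X = mspace (fst X)"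

definition full_pm_iso :: "'a pm \<Rightarrow> 'a pm \<Rightarrow> bool" where
  "full_pm_iso X Y \<longleftrightarrow> full_pm_space X \<and> full_pm_space Y \<and> pm_iso X Y"


subsection \<open>The notions on representatives\<close>

definition raw_lip_le :: "'a pm \<Rightarrow> 'a pm \<Rightarrow> bool" where
  "raw_lip_le Y X \<longleftrightarrow> (\<exists>\<phi>. \<phi> \<in> mspace (fst X) \<rightarrow> mspace (fst Y) \<and>
     (\<forall>x \<in> mspace (fst X). \<forall>y \<in> mspace (fst X). mdist (fst Y) (\<phi> x) (\<phi> y) \<le> mdist (fst X) x y) \<and>
     distr (snd X) (snd Y) \<phi> = snd Y)"

text \<open>Borel (not Lebesgue) measurability of parameters is intended, hence \<open>lborel\<close>.\<close>

definition unit_interval_measure :: "real measure" where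
  "unit_interval_measure = restrict_space lborel {0..1}"

definition pm_parameters :: "'a pm \<Rightarrow> (real \<Rightarrow> 'a) set" where
  "pm_parameters X = {a \<in> measurable unit_interval_measure (snd X).
     distr unit_interval_measure (snd X) a = snd X}"

text \<open>The infimum is taken in \<open>ennreal\<close> only so that it needs no nonemptiness side condition.\<close>

definition raw_box :: "'a pm \<Rightarrow> 'a pm \<Rightarrow> ennreal" where
  "raw_box X Y = Inf {ennreal \<epsilon> | \<epsilon>. \<epsilon> > 0 \<and>
     (\<exists>a \<in> pm_parameters X. \<exists>b \<in> pm_parameters Y. \<exists>I0 \<in> sets borel. I0 \<subseteq> {0..1} \<and>
        measure lborel I0 \<ge> 1 - \<epsilon> \<and>
        (\<forall>s \<in> I0. \<forall>t \<in> I0. \<bar>mdist (fst X) (a s) (a t) - mdist (fst Y) (b s) (b t)\<bar> \<le> \<epsilon>))}"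

definition lip1 :: "'a pm \<Rightarrow> ('a \<Rightarrow> real) set" where
  "lip1 X = {f. \<forall>x \<in> mspace (fst X). \<forall>y \<in> mspace (fst X). \<bar>f x - f y\<bar> \<le> mdist (fst X) x y}"

definition fun_variance :: "'a pm \<Rightarrow> ('a \<Rightarrow> real) \<Rightarrow> ennreal" where
  "fun_variance X f = (\<integral>\<^sup>+ p. ennreal ((f (fst p) - f (snd p))\<^sup>2) \<partial>(snd X \<Otimes>\<^sub>M snd X)) / 2"

definition raw_variance :: "'a pm \<Rightarrow> ennreal" where
  "raw_variance X = (SUP f \<in> lip1 X. fun_variance X f)"

text \<open>Only \<open>t > 0\<close> is meaningful; the other branch makes the function total.\<close>

definition raw_scale :: "real \<Rightarrow> 'a pm \<Rightarrow> 'a pm" where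
  "raw_scale t X = (if t > 0
     then (metric (mspace (fst X), \<lambda>x y. t * mdist (fst X) x y), snd X) else X)"


subsection \<open>Isomorphisms between fully supported spaces\<close>

lemma restrict_space_whole: "restrict_space M (space M) = M"
  by (rule measure_eqI) (auto simp: sets_restrict_space emeasure_restrict_space
      dest: sets.sets_into_space intro!: image_eqI)

lemma lip_measurable:
  assumes X: "pm_space X" and Y: "pm_space Y"
    and f: "f \<in> mspace (fst X) \<rightarrow> mspace (fst Y)"
    and lip: "\<And>x y. x \<in> mspace (fst X) \<Longrightarrow> y \<in> mspace (fst X) \<Longrightarrow>
                mdist (fst Y) (f x) (f y) \<le> mdist (fst X) x y"
  shows "f \<in> measurable (snd X) (snd Y)"
proof (rule measurable_sigma_sets)
  show "sets (snd Y) = sigma_sets (mspace (fst Y)) {U. openin (mtopology_of (fst Y)) U}"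
    using Y by (auto simp: pm_space_def)
  show "{U. openin (mtopology_of (fst Y)) U} \<subseteq> Pow (mspace (fst Y))"
    using openin_subset by fastforce
  show "f \<in> space (snd X) \<rightarrow> mspace (fst Y)"
    using X f by (auto simp: pm_space_def)
  fix U assume "U \<in> {U. openin (mtopology_of (fst Y)) U}"
  moreover have "Lipschitz_continuous_map (fst X) (fst Y) f"
    using f lip by (auto simp: Lipschitz_continuous_map_def intro!: exI[of _ 1])
  then have "continuous_map (mtopology_of (fst X)) (mtopology_of (fst Y)) f"
    by (rule Lipschitz_continuous_imp_continuous_map)
  ultimately have "openin (mtopology_of (fst X)) {x \<in> mspace (fst X). f x \<in> U}"
    using openin_continuous_map_preimage by fastforce
  moreover have "f -` U \<inter> space (snd X) = {x \<in> mspace (fst X). f x \<in> U}"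
    using X by (auto simp: pm_space_def)
  ultimately show "f -` U \<inter> space (snd X) \<in> sets (snd X)"
    using X by (auto simp: pm_space_def)
qed

lemma space_pm: "pm_space X \<Longrightarrow> space (snd X) = mspace (fst X)"
  by (auto simp: pm_space_def)

lemma full_pm_isometryE:
  assumes X: "full_pm_space X" and Y: "full_pm_space Y" and "pm_iso X Y"
  obtains \<phi> \<psi> where
    "\<phi> \<in> measurable (snd X) (snd Y)" "\<psi> \<in> measurable (snd Y) (snd X)"
    "\<And>x. x \<in> mspace (fst X) \<Longrightarrow> \<phi> x \<in> mspace (fst Y)"
    "\<And>y. y \<in> mspace (fst Y) \<Longrightarrow> \<psi> y \<in> mspace (fst X)"
    "\<And>x. x \<in> mspace (fst X) \<Longrightarrow> \<psi> (\<phi> x) = x"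
    "\<And>y. y \<in> mspace (fst Y) \<Longrightarrow> \<phi> (\<psi> y) = y"
    "\<And>x y. x \<in> mspace (fst X) \<Longrightarrow> y \<in> mspace (fst X) \<Longrightarrow>
       mdist (fst Y) (\<phi> x) (\<phi> y) = mdist (fst X) x y"
    "\<And>x y. x \<in> mspace (fst Y) \<Longrightarrow> y \<in> mspace (fst Y) \<Longrightarrow>
       mdist (fst X) (\<psi> x) (\<psi> y) = mdist (fst Y) x y"
    "distr (snd X) (snd Y) \<phi> = snd Y" "distr (snd Y) (snd X) \<psi> = snd X"
proof -
  have pX: "pm_space X" and pY: "pm_space Y"
    using X Y by (auto simp: full_pm_space_def)
  obtain \<phi> where im: "\<phi> ` mspace (fst X) = mspace (fst Y)"
    and iso: "\<And>x y. x \<in> mspace (fst X) \<Longrightarrow> y \<in> mspace (fst X) \<Longrightarrow>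
       mdist (fst Y) (\<phi> x) (\<phi> y) = mdist (fst X) x y"
    and "distr (restrict_space (snd X) (mspace (fst X))) (snd Y) \<phi> = snd Y"
    using assms by (auto simp: pm_iso_def pm_isometry_def full_pm_space_def)
  then have push: "distr (snd X) (snd Y) \<phi> = snd Y"
    using restrict_space_whole[of "snd X"] by (simp add: space_pm[OF pX])
  have inj: "inj_on \<phi> (mspace (fst X))"
  proof (rule inj_onI)
    fix x y assume xy: "x \<in> mspace (fst X)" "y \<in> mspace (fst X)" "\<phi> x = \<phi> y"
    then have "\<phi> x \<in> mspace (fst Y)" using im by auto
    then have "mdist (fst Y) (\<phi> x) (\<phi> y) = 0" using xy(3) by (metis mdist_zero)
    then have "mdist (fst X) x y = 0" using iso[OF xy(1,2)] by linarith
    then show "x = y" using mdist_zero[OF xy(1,2)] by blast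
  qed
  define \<psi> where "\<psi> = inv_into (mspace (fst X)) \<phi>"
  have f: "\<phi> x \<in> mspace (fst Y)" if "x \<in> mspace (fst X)" for x using that im by auto
  have g: "\<psi> y \<in> mspace (fst X)" if "y \<in> mspace (fst Y)" for y
    using that im by (metis \<psi>_def inv_into_into)
  have gf: "\<psi> (\<phi> x) = x" if "x \<in> mspace (fst X)" for x
    using that inj by (simp add: \<psi>_def)
  have fg: "\<phi> (\<psi> y) = y" if "y \<in> mspace (fst Y)" for y
    using that im by (metis \<psi>_def f_inv_into_f)
  have iso': "mdist (fst X) (\<psi> x) (\<psi> y) = mdist (fst Y) x y"
    if "x \<in> mspace (fst Y)" "y \<in> mspace (fst Y)" for x y
    using iso[OF g[OF that(1)] g[OF that(2)]] that by (simp add: fg)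
  have mf: "\<phi> \<in> measurable (snd X) (snd Y)"
    using f iso by (intro lip_measurable[OF pX pY]) auto
  have mg: "\<psi> \<in> measurable (snd Y) (snd X)"
    using g iso' by (intro lip_measurable[OF pY pX]) auto
  have "distr (snd Y) (snd X) \<psi> = distr (distr (snd X) (snd Y) \<phi>) (snd X) \<psi>"
    by (simp add: push)
  also have "\<dots> = distr (snd X) (snd X) (\<psi> \<circ> \<phi>)"
    by (rule distr_distr[OF mg mf])
  also have "\<dots> = distr (snd X) (snd X) (\<lambda>x. x)"
    by (rule distr_cong) (auto simp: space_pm[OF pX] gf)
  also have "\<dots> = snd X" by (rule distr_id)
  finally have push': "distr (snd Y) (snd X) \<psi> = snd X" .
  show thesis
    by (rule that[of \<phi> \<psi>]; fact mf mg f g gf fg iso iso' push push')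
qed

lemma full_pm_isoI:
  assumes X: "full_pm_space X" and Y: "full_pm_space Y"
    and f: "\<And>x. x \<in> mspace (fst X) \<Longrightarrow> \<phi> x \<in> mspace (fst Y)"
    and surj: "\<And>y. y \<in> mspace (fst Y) \<Longrightarrow> \<exists>x \<in> mspace (fst X). \<phi> x = y"
    and iso: "\<And>x y. x \<in> mspace (fst X) \<Longrightarrow> y \<in> mspace (fst X) \<Longrightarrow>
       mdist (fst Y) (\<phi> x) (\<phi> y) = mdist (fst X) x y"
    and push: "distr (snd X) (snd Y) \<phi> = snd Y"
  shows "full_pm_iso X Y"
proof -
  have "\<phi> ` mspace (fst X) = mspace (fst Y)" using f surj by auto
  moreover have "restrict_space (snd X) (mspace (fst X)) = snd X"
    using X restrict_space_whole[of "snd X"] by (auto simp: full_pm_space_def space_pm)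
  ultimately show ?thesis
    using X Y iso push
    by (auto simp: full_pm_iso_def pm_iso_def pm_isometry_def full_pm_space_def intro!: exI[of _ \<phi>])
qed

lemma full_pm_iso_refl: "full_pm_space X \<Longrightarrow> full_pm_iso X X"
  by (rule full_pm_isoI[where \<phi> = "\<lambda>x. x"]) auto

lemma full_pm_iso_sym: assumes "full_pm_iso X Y" shows "full_pm_iso Y X"
proof -
  have X: "full_pm_space X" and Y: "full_pm_space Y" and i: "pm_iso X Y"
    using assms by (auto simp: full_pm_iso_def)
  show ?thesis
  proof (rule full_pm_isometryE[OF X Y i])
    fix f g
    assume *: "\<And>x. x \<in> mspace (fst X) \<Longrightarrow> f x \<in> mspace (fst Y)"
      "\<And>y. y \<in> mspace (fst Y) \<Longrightarrow> g y \<in> mspace (fst X)"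
      "\<And>x. x \<in> mspace (fst X) \<Longrightarrow> g (f x) = x"
      "\<And>x y. x \<in> mspace (fst Y) \<Longrightarrow> y \<in> mspace (fst Y) \<Longrightarrow>
         mdist (fst X) (g x) (g y) = mdist (fst Y) x y"
      "distr (snd Y) (snd X) g = snd X"
    show "full_pm_iso Y X"
      by (rule full_pm_isoI[OF Y X *(2) _ *(4,5)]) (use * in blast)+
  qed
qed

lemma full_pm_iso_trans:
  assumes "full_pm_iso X Y" "full_pm_iso Y Z" shows "full_pm_iso X Z"
proof -
  have X: "full_pm_space X" and Y: "full_pm_space Y" and Z: "full_pm_space Z"
    and i: "pm_iso X Y" and j: "pm_iso Y Z"
    using assms by (auto simp: full_pm_iso_def)
  obtain f f' where f: "f \<in> measurable (snd X) (snd Y)"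
    "\<And>x. x \<in> mspace (fst X) \<Longrightarrow> f x \<in> mspace (fst Y)"
    "\<And>y. y \<in> mspace (fst Y) \<Longrightarrow> f' y \<in> mspace (fst X)"
    "\<And>y. y \<in> mspace (fst Y) \<Longrightarrow> f (f' y) = y"
    "\<And>x y. x \<in> mspace (fst X) \<Longrightarrow> y \<in> mspace (fst X) \<Longrightarrow>
       mdist (fst Y) (f x) (f y) = mdist (fst X) x y"
    "distr (snd X) (snd Y) f = snd Y"
    by (rule full_pm_isometryE[OF X Y i]) (rule that; blast)
  obtain g g' where g: "g \<in> measurable (snd Y) (snd Z)"
    "\<And>x. x \<in> mspace (fst Y) \<Longrightarrow> g x \<in> mspace (fst Z)"
    "\<And>y. y \<in> mspace (fst Z) \<Longrightarrow> g' y \<in> mspace (fst Y)"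
    "\<And>y. y \<in> mspace (fst Z) \<Longrightarrow> g (g' y) = y"
    "\<And>x y. x \<in> mspace (fst Y) \<Longrightarrow> y \<in> mspace (fst Y) \<Longrightarrow>
       mdist (fst Z) (g x) (g y) = mdist (fst Y) x y"
    "distr (snd Y) (snd Z) g = snd Z"
    by (rule full_pm_isometryE[OF Y Z j]) (rule that; blast)
  have p: "distr (snd X) (snd Z) (g \<circ> f) = snd Z"
    using distr_distr[OF g(1) f(1)] f(6) g(6) by simp
  show ?thesis
  proof (rule full_pm_isoI[OF X Z _ _ _ p])
    show "\<exists>x \<in> mspace (fst X). (g \<circ> f) x = z" if "z \<in> mspace (fst Z)" for z
      using that f(3,4) g(3,4) by (intro bexI[of _ "f' (g' z)"]) auto
  qed (use f(2,5) g(2,5) in auto)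
qed

lemma full_pm_space_exists: "\<exists>X :: 'a pm. full_pm_space X"
proof -
  define d :: "'a metric" where "d = metric ({undefined}, \<lambda>x y. if x = y then 0 else 1)"
  define X where "X = (d, uniform_count_measure {undefined :: 'a})"
  interpret D: discrete_metric "{undefined :: 'a}" .
  have d: "d = metric ({undefined}, D.dd)"
    by (simp add: d_def D.dd_def)
  have top: "mtopology_of d = discrete_topology {undefined}"
    unfolding d by (simp add: D.disc.mtopology_of D.mtopology_discrete_metric)
  have ms: "mspace d = {undefined}"
    unfolding d by (simp add: D.disc.mspace_metric)
  have "mcomplete_of d"
    unfolding d by (simp add: D.disc.mcomplete_of D.mcomplete_discrete_metric)
  moreover have "separable_space (mtopology_of d)"
    unfolding top by (simp add: separable_space_discrete_topology)
  moreover have "prob_space (snd X)"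
    unfolding X_def snd_conv by (rule prob_space_uniform_count_measure) auto
  moreover have "sets (snd X) = sigma_sets (mspace d) {U. openin (mtopology_of d) U}"
    by (simp add: X_def ms top sets_uniform_count_measure Pow_def[symmetric]
        sigma_algebra.sigma_sets_eq[OF sigma_algebra_Pow])
  ultimately have "pm_space X"
    by (simp add: pm_space_def X_def ms space_uniform_count_measure)
  moreover have "pm_supp X = mspace (fst X)"
    by (auto simp: pm_supp_def X_def ms top emeasure_uniform_count_measure
        card_gt_0_iff intro: finite_subset)
  ultimately show ?thesis unfolding full_pm_space_def by blast
qed

lemma full_pm_iso_part_equivp: "part_equivp (full_pm_iso :: 'a pm \<Rightarrow> 'a pm \<Rightarrow> bool)"
proof (rule part_equivpI)
  show "\<exists>X :: 'a pm. full_pm_iso X X"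
    using full_pm_space_exists full_pm_iso_refl by blast
  show "symp (full_pm_iso :: 'a pm \<Rightarrow> 'a pm \<Rightarrow> bool)"
    by (rule sympI) (rule full_pm_iso_sym)
  show "transp (full_pm_iso :: 'a pm \<Rightarrow> 'a pm \<Rightarrow> bool)"
    by (rule transpI) (rule full_pm_iso_trans)
qed


subsection \<open>Every pm-space is isomorphic to a fully supported one carried by a set of reals\<close>

lemma pm_supp_closed_full:
  assumes X: "pm_space X"
  shows "closedin (mtopology_of (fst X)) (pm_supp X)"
    and "mspace (fst X) - pm_supp X \<in> null_sets (snd X)"
proof -
  obtain d m where Xdm: "X = (d, m)" by fastforce
  interpret M: Metric_space "mspace d" "mdist d" by (rule Metric_space_mspace_mdist)
  have top: "mtopology_of d = M.mtopology" by (simp add: mtopology_of_def)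
  have S: "pm_supp X \<subseteq> mspace d" by (auto simp: pm_supp_def Xdm)
  obtain D where D: "countable D" "D \<subseteq> mspace d" "mtopology_of d closure_of D = mspace d"
    using X by (auto simp: pm_space_def Xdm separable_space_def)
  have open_sets: "U \<in> sets m" if "openin M.mtopology U" for U
    using X that by (auto simp: pm_space_def Xdm top)
  define B where "B = {(p, n). p \<in> D \<and> emeasure m (M.mball p (1 / real (Suc n))) = 0}"
  define W where "W = (\<Union>(p, n) \<in> B. M.mball p (1 / real (Suc n)))"
  have "B \<subseteq> D \<times> UNIV" by (auto simp: B_def)
  then have cB: "countable B" by (rule countable_subset) (use D in auto)
  have oW: "openin M.mtopology W" unfolding W_def by (intro openin_Union) auto
  have nW: "W \<in> null_sets m"
    unfolding W_def using cB
    by (intro null_sets_UN') (auto simp: B_def null_sets_def intro!: open_sets)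
  have "mspace d - pm_supp X = W"
  proof (intro equalityI subsetI)
    fix x assume x: "x \<in> mspace d - pm_supp X"
    then obtain U where U: "openin M.mtopology U" "x \<in> U" "emeasure m U = 0"
      by (auto simp: pm_supp_def Xdm top)
    then obtain r where r: "r > 0" "M.mball x r \<subseteq> U" by (meson M.openin_mtopology)
    obtain n where n: "1 / real (Suc n) < r / 2"
      using r(1) nat_approx_posE[of "r/2"] by auto
    have "x \<in> M.mtopology closure_of D" using x D(3) by (simp add: top)
    then obtain p where p: "p \<in> D" "p \<in> M.mball x (1 / real (Suc n))"
      unfolding M.metric_closure_of
        by (auto simp del: of_nat_Suc dest!: spec[of _ "1 / real (Suc n)"])
    have xp: "mdist d p x < 1 / real (Suc n)" using p by (simp add: M.commute)
    have "M.mball p (1 / real (Suc n)) \<subseteq> M.mball x r"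
    proof
      fix y assume y: "y \<in> M.mball p (1 / real (Suc n))"
      then have "mdist d x y \<le> mdist d x p + mdist d p y"
        using x p by (intro M.triangle) auto
      also have "\<dots> < r" using y xp n by (simp add: M.commute del: of_nat_Suc)
      finally show "y \<in> M.mball x r" using y x by auto
    qed
    then have "emeasure m (M.mball p (1 / real (Suc n))) \<le> emeasure m U"
      using r U by (intro emeasure_mono open_sets) auto
    then have "(p, n) \<in> B" using p U by (simp add: B_def)
    moreover have "x \<in> M.mball p (1 / real (Suc n))" using xp x p by auto
    ultimately show "x \<in> W" unfolding W_def by blast
  next
    fix x assume "x \<in> W"
    then obtain p n where pn: "(p, n) \<in> B" "x \<in> M.mball p (1 / real (Suc n))"
      by (auto simp: W_def)
    then have "x \<notin> pm_supp X"
      using M.openin_mball by (force simp: pm_supp_def Xdm top B_def)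
    then show "x \<in> mspace d - pm_supp X" using pn by auto
  qed
  then show "mspace (fst X) - pm_supp X \<in> null_sets (snd X)"
    and "closedin (mtopology_of (fst X)) (pm_supp X)"
    using nW oW S by (auto simp: Xdm top closedin_def)
qed

lemma separable_submetric:
  assumes "separable_space (mtopology_of d)"
  shows "separable_space (mtopology_of (submetric d S))"
proof -
  interpret M: Metric_space "mspace d" "mdist d" by (rule Metric_space_mspace_mdist)
  interpret N: Metric_space "S \<inter> mspace d" "mdist d" by (rule M.subspace) auto
  have top: "mtopology_of d = M.mtopology" "mtopology_of (submetric d S) = N.mtopology"
    by (simp_all add: mtopology_of_def)
  obtain D where D: "countable D" "D \<subseteq> mspace d" "M.mtopology closure_of D = mspace d"
    using assms by (auto simp: separable_space_def top)
  define P where "P = (\<lambda>(p, n). \<lambda>y. y \<in> S \<inter> mspace d \<and> mdist d p y < 1 / real (Suc n))"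
  define I where "I = {q \<in> D \<times> UNIV. \<exists>y. P q y}"
  define E where "E = (\<lambda>q. SOME y. P q y) ` I"
  have "countable I" unfolding I_def by (rule countable_subset[of _ "D \<times> UNIV"]) (use D in auto)
  then have cE: "countable E" by (simp add: E_def)
  have PE: "P q (SOME y. P q y)" if "q \<in> I" for q
    using that by (auto simp: I_def intro: someI_ex)
  have sub: "E \<subseteq> S \<inter> mspace d" using PE by (fastforce simp: E_def P_def)
  have "x \<in> N.mtopology closure_of E" if x: "x \<in> S \<inter> mspace d" for x
  proof -
    have "\<exists>y \<in> E. y \<in> N.mball x r" if r: "r > 0" for r
    proof -
      obtain n where n: "1 / real (Suc n) < r / 2"
        using r nat_approx_posE[of "r/2"] by auto
      have "x \<in> M.mtopology closure_of D" using x D(3) by simp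
      then obtain p where p: "p \<in> D" "p \<in> M.mball x (1 / real (Suc n))"
        unfolding M.metric_closure_of
        by (auto simp del: of_nat_Suc dest!: spec[of _ "1 / real (Suc n)"])
      then have "P (p, n) x" using x by (simp add: P_def M.commute)
      then have "(p, n) \<in> I" using p by (auto simp: I_def)
      from PE[OF this] obtain y where y: "y \<in> E" "P (p, n) y"
        using \<open>(p, n) \<in> I\<close> by (auto simp: E_def)
      have "mdist d x y \<le> mdist d x p + mdist d p y"
        using x p y by (intro M.triangle) (auto simp: P_def)
      also have "\<dots> < r" using y(2) p n by (simp add: P_def del: of_nat_Suc)
      finally show ?thesis using y x by (auto simp: P_def)
    qed
    then show ?thesis using x by (auto simp: N.metric_closure_of)
  qed
  then have "N.mtopology closure_of E = topspace N.mtopology"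
    using closure_of_subset_topspace[of N.mtopology E] by auto
  then show ?thesis
    using cE sub by (auto simp: separable_space_def top)
qed

lemma separable_metric_inj_real:
  assumes "separable_space (mtopology_of d)"
  obtains g :: "'a \<Rightarrow> real" where "inj_on g (mspace (d :: 'a metric))"
proof -
  interpret M: Metric_space "mspace d" "mdist d" by (rule Metric_space_mspace_mdist)
  have top: "mtopology_of d = M.mtopology" by (simp add: mtopology_of_def)
  obtain D where D: "countable D" "D \<subseteq> mspace d" "M.mtopology closure_of D = mspace d"
    using assms by (auto simp: separable_space_def top)
  obtain h :: "nat set \<Rightarrow> real" where h: "inj h"
    using nat_sets_eqpoll_reals by (auto simp: eqpoll_def bij_betw_def)
  define c where "c x = {prod_encode (to_nat_on D p, n) | p n. p \<in> D \<and> mdist d x p < 1 / real (Suc n)}"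
    for x
  have c: "prod_encode (to_nat_on D p, n) \<in> c x \<longleftrightarrow> mdist d x p < 1 / real (Suc n)"
    if "p \<in> D" for p n x
  proof
    assume "prod_encode (to_nat_on D p, n) \<in> c x"
    then obtain q where "q \<in> D" "to_nat_on D p = to_nat_on D q" "mdist d x q < 1 / real (Suc n)"
      by (auto simp: c_def simp del: of_nat_Suc)
    then show "mdist d x p < 1 / real (Suc n)"
      using inj_on_to_nat_on[OF D(1)] that by (metis inj_onD)
  qed (use that in \<open>auto simp: c_def simp del: of_nat_Suc\<close>)
  have "inj_on c (mspace d)"
  proof (rule inj_onI, rule ccontr)
    fix x y assume xy: "x \<in> mspace d" "y \<in> mspace d" "c x = c y" "x \<noteq> y"
    then have "mdist d x y > 0" using M.mdist_pos_eq by blast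
    then obtain n where n: "1 / real (Suc n) < mdist d x y / 2"
      using nat_approx_posE[of "mdist d x y / 2"] by auto
    have "x \<in> M.mtopology closure_of D" using xy D(3) by simp
    then obtain p where p: "p \<in> D" "p \<in> M.mball x (1 / real (Suc n))"
      unfolding M.metric_closure_of
        by (auto simp del: of_nat_Suc dest!: spec[of _ "1 / real (Suc n)"])
    then have px: "mdist d x p < 1 / real (Suc n)" by simp
    then have "mdist d y p < 1 / real (Suc n)" using c[OF p(1)] xy(3) by metis
    moreover have "mdist d x y \<le> mdist d x p + mdist d p y"
      using xy p by (intro M.triangle) auto
    ultimately show False using px n M.commute[of p y] by linarith
  qed
  then have "inj_on (h \<circ> c) (mspace d)"
    using h by (meson comp_inj_on inj_on_subset subset_UNIV)
  then show thesis by (rule that)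
qed

theorem full_pm_representative:
  assumes X: "pm_space (X :: 'a pm)"
  shows "\<exists>Y :: real pm. full_pm_space Y \<and> pm_iso X Y"
proof -
  obtain d m where Xdm: "X = (d, m)" by fastforce
  define S where "S = pm_supp X"
  define e where "e = submetric d S"
  have S: "S \<subseteq> mspace d" by (auto simp: S_def pm_supp_def Xdm)
  have spm: "space m = mspace d" using X by (simp add: pm_space_def Xdm)
  interpret P: prob_space m using X by (simp add: pm_space_def Xdm)
  have null: "mspace d - S \<in> null_sets m" and cl: "closedin (mtopology_of d) S"
    using pm_supp_closed_full[OF X] by (simp_all add: Xdm S_def)
  have open_sets: "U \<in> sets m" if "openin (mtopology_of d) U" for U
    using X that by (auto simp: pm_space_def Xdm)
  have Sm: "S \<in> sets m"
    using null S sets.compl_sets[of "mspace d - S" m]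
    by (auto simp: spm double_diff null_sets_def)
  have eS: "emeasure m (S \<inter> A) = emeasure m A" if "A \<in> sets m" for A
  proof -
    have "emeasure m (A - (mspace d - S)) = emeasure m A"
      by (rule emeasure_Diff_null_set[OF null that])
    moreover have "A - (mspace d - S) = S \<inter> A"
      using sets.sets_into_space[OF that] by (auto simp: spm)
    ultimately show ?thesis by simp
  qed
  interpret M: Metric_space "mspace d" "mdist d" by (rule Metric_space_mspace_mdist)
  interpret SM: Submetric "mspace d" "mdist d" S by unfold_locales (rule S)
  have mse: "mspace e = S" using S by (auto simp: e_def)
  have compe: "SM.sub.mcomplete"
    using SM.closedin_eq_mcomplete X cl by (simp add: pm_space_def Xdm mcomplete_of_def mtopology_of_def)
  have sepe: "separable_space (mtopology_of e)"
    using X by (auto simp: e_def pm_space_def Xdm intro: separable_submetric)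
  have tope: "mtopology_of e = SM.sub.mtopology"
    using mse by (simp add: mtopology_of_def e_def)
  obtain g :: "'a \<Rightarrow> real" where g: "inj_on g S"
    using separable_metric_inj_real[OF sepe] mse by metis
  define k where "k = inv_into S g"
  have kg [simp]: "k (g x) = x" if "x \<in> S" for x using g that by (simp add: k_def)
  have kS [simp]: "k u \<in> S" if "u \<in> g ` S" for u using that by auto
  have gk [simp]: "g (k u) = u" if "u \<in> g ` S" for u using that by auto
  define d' where "d' = metric (g ` S, \<lambda>u v. mdist d (k u) (k v))"
  interpret R: Metric_space "g ` S" "\<lambda>u v. mdist d (k u) (k v)"
  proof
    show "mdist d (k u) (k w) \<le> mdist d (k u) (k v) + mdist d (k v) (k w)"
      if "u \<in> g ` S" "v \<in> g ` S" "w \<in> g ` S" for u v w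
      using that S by (intro M.triangle) auto
    show "(mdist d (k u) (k v) = 0) = (u = v)" if "u \<in> g ` S" "v \<in> g ` S" for u v
      using that S g by (auto simp: inj_on_eq_iff subset_iff)
  qed (auto simp: M.commute)
  have ms': "mspace d' = g ` S" and md': "mdist d' = (\<lambda>u v. mdist d (k u) (k v))"
    unfolding d'_def by (rule R.mspace_metric, rule R.mdist_metric)
  have top': "mtopology_of d' = R.mtopology" by (simp add: mtopology_of_def ms' md')
  have cg: "continuous_map SM.sub.mtopology R.mtopology g"
  proof -
    have "Lipschitz_continuous_map e d' g"
      unfolding Lipschitz_continuous_map_def mse ms' md'
      by (auto simp: e_def intro!: exI[of _ 1])
    then show ?thesis
      using Lipschitz_continuous_imp_continuous_map by (fastforce simp: top' tope)
  qed
  have cmp: "R.mcomplete"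
    unfolding R.mcomplete_def
  proof (intro allI impI)
    fix \<sigma> assume c: "R.MCauchy \<sigma>"
    then have rg: "range \<sigma> \<subseteq> g ` S" by (simp add: R.MCauchy_def)
    have "SM.sub.MCauchy (k \<circ> \<sigma>)"
      using c rg by (auto simp: R.MCauchy_def SM.sub.MCauchy_def image_subset_iff subset_iff)
    then obtain x where "limitin SM.sub.mtopology (k \<circ> \<sigma>) x sequentially"
      using compe by (auto simp: SM.sub.mcomplete_def)
    then have "limitin R.mtopology (g \<circ> (k \<circ> \<sigma>)) (g x) sequentially"
      by (rule continuous_map_limit[OF cg])
    moreover have "g \<circ> (k \<circ> \<sigma>) = \<sigma>"
    proof
      fix n have "\<sigma> n \<in> g ` S" using rg by auto
      then show "(g \<circ> (k \<circ> \<sigma>)) n = \<sigma> n" by (simp only: o_apply gk)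
    qed
    ultimately show "\<exists>x. limitin R.mtopology \<sigma> x sequentially" by metis
  qed
  have "separable_space R.mtopology"
    by (rule separable_space_continuous_map_image[OF sepe[unfolded tope] cg]) simp
  note sep = this
  have pre: "\<exists>U. openin (mtopology_of d) U \<and> g -` V \<inter> S = S \<inter> U"
    if V: "openin R.mtopology V" for V
  proof -
    have "openin SM.sub.mtopology {x \<in> S. g x \<in> V}"
      using openin_continuous_map_preimage[OF cg V] by simp
    then have "openin (subtopology M.mtopology S) {x \<in> S. g x \<in> V}"
      by (simp add: SM.mtopology_submetric)
    then show ?thesis
      by (auto simp: openin_subtopology mtopology_of_def)
  qed
  define m' where "m' = distr (restrict_space m S) (sigma (g ` S) {V. openin R.mtopology V}) g"
  have opPow: "{V. openin R.mtopology V} \<subseteq> Pow (g ` S)"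
    using openin_subset by fastforce
  have spr: "space (restrict_space m S) = S" using S by (auto simp: space_restrict_space spm)
  have gm: "g \<in> measurable (restrict_space m S) (sigma (g ` S) {V. openin R.mtopology V})"
  proof (rule measurable_measure_of[OF opPow])
    show "g \<in> space (restrict_space m S) \<rightarrow> g ` S" by (simp add: spr)
    fix V assume "V \<in> {V. openin R.mtopology V}"
    then obtain U where "openin (mtopology_of d) U" "g -` V \<inter> S = S \<inter> U" using pre by auto
    then show "g -` V \<inter> space (restrict_space m S) \<in> sets (restrict_space m S)"
      using open_sets by (auto simp: spr sets_restrict_space)
  qed
  have "emeasure m S = 1"
    using eS[OF sets.top] S P.emeasure_space_1 by (simp add: spm Int_absorb2)
  note mS = this
  have pr: "prob_space (restrict_space m S)"
    by (rule prob_spaceI, unfold spr, subst emeasure_restrict_space)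
      (use Sm S mS in \<open>simp_all add: spm Int_absorb2\<close>)
  define Y where "Y = (d', m')"
  have pY: "pm_space Y"
    unfolding pm_space_def Y_def prod.case
  proof (intro conjI)
    show "mcomplete_of d'" using cmp by (simp add: mcomplete_of_def ms' md')
    show "separable_space (mtopology_of d')" using sep by (simp add: top')
    show "prob_space m'" unfolding m'_def by (rule prob_space.prob_space_distr[OF pr gm])
    show "space m' = mspace d'" using opPow by (simp add: m'_def ms')
    show "sets m' = sigma_sets (mspace d') {U. openin (mtopology_of d') U}"
      using opPow by (simp add: m'_def ms' top')
  qed
  have sY: "pm_supp Y = g ` S"
  proof -
    have "0 < emeasure m' V" if h: "x \<in> S" "openin R.mtopology V" "g x \<in> V" for x V
    proof -
      obtain U where U: "openin (mtopology_of d) U" "g -` V \<inter> S = S \<inter> U" using pre[OF h(2)] by blast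
      then have "x \<in> U" using h by auto
      then have "0 < emeasure m U" using h U by (auto simp: S_def pm_supp_def Xdm)
      also have "\<dots> = emeasure m (S \<inter> U)" using eS open_sets U by simp
      also have "\<dots> = emeasure (restrict_space m S) (S \<inter> U)"
        using Sm S by (intro emeasure_restrict_space[symmetric]) (auto simp: spm Int_absorb2)
      also have "\<dots> = emeasure m' V"
        using h opPow unfolding m'_def
        by (subst emeasure_distr[OF gm]) (auto simp: spr U)
      finally show ?thesis .
    qed
    then show ?thesis by (auto simp: pm_supp_def Y_def ms' top')
  qed
  have "pm_isometry X Y g"
    unfolding pm_isometry_def sY S_def[symmetric]
  proof (intro conjI ballI)
    show "distr (restrict_space (snd X) S) (snd Y) g = snd Y"
      by (simp add: Xdm Y_def m'_def cong: distr_cong)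
  qed (auto simp: Xdm Y_def md')
  then show ?thesis
    using pY sY unfolding pm_iso_def full_pm_space_def
    by (intro exI[of _ Y] exI[of _ g] conjI) (auto simp: Y_def ms')
qed


subsection \<open>Invariance under isomorphism\<close>

lemma raw_lip_le_iso:
  assumes "full_pm_iso Y Y'" "full_pm_iso X X'" "raw_lip_le Y X"
  shows "raw_lip_le Y' X'"
proof -
  have full: "full_pm_space X" "full_pm_space X'" "full_pm_space Y" "full_pm_space Y'"
    and i: "pm_iso X X'" "pm_iso Y Y'"
    using assms by (auto simp: full_pm_iso_def)
  obtain \<phi> where \<phi>: "\<And>x. x \<in> mspace (fst X) \<Longrightarrow> \<phi> x \<in> mspace (fst Y)"
    "\<And>x y. x \<in> mspace (fst X) \<Longrightarrow> y \<in> mspace (fst X) \<Longrightarrow>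
       mdist (fst Y) (\<phi> x) (\<phi> y) \<le> mdist (fst X) x y"
    "distr (snd X) (snd Y) \<phi> = snd Y"
    using assms(3) by (auto simp: raw_lip_le_def)
  have m\<phi>: "\<phi> \<in> measurable (snd X) (snd Y)"
    using full \<phi>(1,2) by (intro lip_measurable) (auto simp: full_pm_space_def)
  show ?thesis
  proof (rule full_pm_isometryE[OF full(1,2) i(1)], rule full_pm_isometryE[OF full(3,4) i(2)])
    fix a b p q
    assume a: "b \<in> measurable (snd X') (snd X)"
      "\<And>x. x \<in> mspace (fst X') \<Longrightarrow> b x \<in> mspace (fst X)"
      "\<And>x y. x \<in> mspace (fst X') \<Longrightarrow> y \<in> mspace (fst X') \<Longrightarrow>
         mdist (fst X) (b x) (b y) = mdist (fst X') x y"
      "distr (snd X') (snd X) b = snd X"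
    assume p: "p \<in> measurable (snd Y) (snd Y')"
      "\<And>x. x \<in> mspace (fst Y) \<Longrightarrow> p x \<in> mspace (fst Y')"
      "\<And>x y. x \<in> mspace (fst Y) \<Longrightarrow> y \<in> mspace (fst Y) \<Longrightarrow>
         mdist (fst Y') (p x) (p y) = mdist (fst Y) x y"
      "distr (snd Y) (snd Y') p = snd Y'"
    have "distr (snd X') (snd Y') (p \<circ> (\<phi> \<circ> b)) = snd Y'"
      using distr_distr[OF p(1) measurable_comp[OF a(1) m\<phi>]] distr_distr[OF m\<phi> a(1)]
      by (simp add: a(4) \<phi>(3) p(4))
    moreover have "mdist (fst Y') (p (\<phi> (b x))) (p (\<phi> (b y))) \<le> mdist (fst X') x y"
      if "x \<in> mspace (fst X')" "y \<in> mspace (fst X')" for x y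
      using \<phi>(2)[OF a(2)[OF that(1)] a(2)[OF that(2)]] that by (simp add: a(2,3) p(3) \<phi>(1))
    ultimately show "raw_lip_le Y' X'"
      unfolding raw_lip_le_def
      by (intro exI[of _ "p \<circ> (\<phi> \<circ> b)"]) (auto simp: a(2) \<phi>(1) p(2))
  qed
qed

lemma raw_box_iso_le:
  assumes "full_pm_iso X X'" "full_pm_iso Y Y'"
  shows "raw_box X' Y' \<le> raw_box X Y"
proof -
  have param: "\<exists>a' \<in> pm_parameters X'. \<forall>s \<in> {0..1}. \<forall>t \<in> {0..1}.
      mdist (fst X') (a' s) (a' t) = mdist (fst X) (a s) (a t)"
    if "full_pm_iso X X'" and a: "a \<in> pm_parameters X" for a and X X' :: "'a pm"
  proof -
    have full: "full_pm_space X" "full_pm_space X'" and i: "pm_iso X X'"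
      using that by (auto simp: full_pm_iso_def)
    have am: "a \<in> measurable unit_interval_measure (snd X)"
      and ad: "distr unit_interval_measure (snd X) a = snd X"
      using a by (auto simp: pm_parameters_def)
    have as: "a s \<in> mspace (fst X)" if "s \<in> {0..1}" for s
      using measurable_space[OF am, of s] that full
      by (simp add: full_pm_space_def space_pm unit_interval_measure_def space_restrict_space)
    show ?thesis
    proof (rule full_pm_isometryE[OF full i])
      fix p
      assume p: "p \<in> measurable (snd X) (snd X')"
        "\<And>x y. x \<in> mspace (fst X) \<Longrightarrow> y \<in> mspace (fst X) \<Longrightarrow>
           mdist (fst X') (p x) (p y) = mdist (fst X) x y"
        "distr (snd X) (snd X') p = snd X'"
      have "p \<circ> a \<in> pm_parameters X'"
        using measurable_comp[OF am p(1)] distr_distr[OF p(1) am]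
        by (simp add: pm_parameters_def ad p(3))
      then show ?thesis by (rule bexI[rotated]) (auto simp: p(2) as)
    qed
  qed
  show ?thesis
    unfolding raw_box_def
  proof (rule Inf_superset_mono, clarify)
    fix \<epsilon> :: real and a b I0
    assume e: "\<epsilon> > 0" and a: "a \<in> pm_parameters X" and b: "b \<in> pm_parameters Y"
      and I0: "I0 \<in> sets borel" "I0 \<subseteq> {0..1}" "1 - \<epsilon> \<le> measure lborel I0"
      and d: "\<forall>s \<in> I0. \<forall>t \<in> I0. \<bar>mdist (fst X) (a s) (a t) - mdist (fst Y) (b s) (b t)\<bar> \<le> \<epsilon>"
    obtain a' where a': "a' \<in> pm_parameters X'" "\<forall>s \<in> {0..1}. \<forall>t \<in> {0..1}.
      mdist (fst X') (a' s) (a' t) = mdist (fst X) (a s) (a t)"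
      using param[OF assms(1) a] by blast
    obtain b' where b': "b' \<in> pm_parameters Y'" "\<forall>s \<in> {0..1}. \<forall>t \<in> {0..1}.
      mdist (fst Y') (b' s) (b' t) = mdist (fst Y) (b s) (b t)"
      using param[OF assms(2) b] by blast
    have "\<forall>s \<in> I0. \<forall>t \<in> I0. \<bar>mdist (fst X') (a' s) (a' t) - mdist (fst Y') (b' s) (b' t)\<bar> \<le> \<epsilon>"
    proof (intro ballI)
      fix s t assume st: "s \<in> I0" "t \<in> I0"
      then have "s \<in> {0..1}" "t \<in> {0..1}" using I0(2) by auto
      then show "\<bar>mdist (fst X') (a' s) (a' t) - mdist (fst Y') (b' s) (b' t)\<bar> \<le> \<epsilon>"
        using a'(2) b'(2) d st by simp
    qed
    then show "\<exists>\<epsilon>'. ennreal \<epsilon> = ennreal \<epsilon>' \<and> 0 < \<epsilon>' \<and>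
      (\<exists>a \<in> pm_parameters X'. \<exists>b \<in> pm_parameters Y'. \<exists>I0 \<in> sets borel. I0 \<subseteq> {0..1} \<and>
        1 - \<epsilon>' \<le> measure lborel I0 \<and>
        (\<forall>s \<in> I0. \<forall>t \<in> I0. \<bar>mdist (fst X') (a s) (a t) - mdist (fst Y') (b s) (b t)\<bar> \<le> \<epsilon>'))"
      using e a'(1) b'(1) I0 by blast
  qed
qed

lemma lip1_measurable:
  assumes X: "pm_space X" and f: "f \<in> lip1 X"
  shows "f \<in> borel_measurable (snd X)"
proof (rule borel_measurableI)
  fix U :: "real set" assume U: "open U"
  have "Lipschitz_continuous_map (fst X) euclidean_metric f"
    using f by (auto simp: Lipschitz_continuous_map_def lip1_def dist_real_def intro!: exI[of _ 1])
  then have "continuous_map (mtopology_of (fst X)) euclidean f"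
    using Lipschitz_continuous_imp_continuous_map by fastforce
  then have "openin (mtopology_of (fst X)) {x \<in> mspace (fst X). f x \<in> U}"
    using U openin_continuous_map_preimage by fastforce
  moreover have "f -` U \<inter> space (snd X) = {x \<in> mspace (fst X). f x \<in> U}"
    using X by (auto simp: space_pm)
  ultimately show "f -` U \<inter> space (snd X) \<in> sets (snd X)"
    using X by (auto simp: pm_space_def)
qed

lemma raw_variance_iso_le:
  assumes "full_pm_iso X Y"
  shows "raw_variance X \<le> raw_variance Y"
proof -
  have full: "full_pm_space X" "full_pm_space Y" and i: "pm_iso X Y"
    using assms by (auto simp: full_pm_iso_def)
  have pX: "pm_space X" and pY: "pm_space Y" using full by (auto simp: full_pm_space_def)
  interpret MX: prob_space "snd X" using pX by (auto simp: pm_space_def)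
  interpret MY: prob_space "snd Y" using pY by (auto simp: pm_space_def)
  show ?thesis
    unfolding raw_variance_def
  proof (rule SUP_mono)
    fix f assume f: "f \<in> lip1 X"
    have fm [measurable]: "f \<in> borel_measurable (snd X)" by (rule lip1_measurable[OF pX f])
    show "\<exists>h \<in> lip1 Y. fun_variance X f \<le> fun_variance Y h"
    proof (rule full_pm_isometryE[OF full i])
      fix q
      assume q [measurable]: "q \<in> measurable (snd Y) (snd X)"
        and qs: "\<And>x. x \<in> mspace (fst Y) \<Longrightarrow> q x \<in> mspace (fst X)"
        "\<And>x y. x \<in> mspace (fst Y) \<Longrightarrow> y \<in> mspace (fst Y) \<Longrightarrow>
           mdist (fst X) (q x) (q y) = mdist (fst Y) x y"
        and qd: "distr (snd Y) (snd X) q = snd X"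
      have "f \<circ> q \<in> lip1 Y" using f qs by (auto simp: lip1_def) (metis qs(1,2))
      moreover have "snd X \<Otimes>\<^sub>M snd X =
          distr (snd Y \<Otimes>\<^sub>M snd Y) (snd X \<Otimes>\<^sub>M snd X) (\<lambda>(x, y). (q x, q y))"
        using pair_measure_distr[OF q q] by (simp add: qd MX.sigma_finite_measure_axioms)
      then have "(\<integral>\<^sup>+ p. ennreal ((f (fst p) - f (snd p))\<^sup>2) \<partial>(snd X \<Otimes>\<^sub>M snd X)) =
          (\<integral>\<^sup>+ p. ennreal ((f (fst p) - f (snd p))\<^sup>2)
            \<partial>(distr (snd Y \<Otimes>\<^sub>M snd Y) (snd X \<Otimes>\<^sub>M snd X) (\<lambda>(x, y). (q x, q y))))"
        by simp
      then have "fun_variance X f = fun_variance Y (f \<circ> q)"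
        unfolding fun_variance_def
        by (simp add: nn_integral_distr split_beta')
      ultimately show ?thesis by (intro bexI[of _ "f \<circ> q"]) auto
    qed
  qed
qed

lemma raw_scale_metric:
  assumes "t > 0"
  shows "mspace (fst (raw_scale t X)) = mspace (fst X)"
    and "mdist (fst (raw_scale t X)) = (\<lambda>x y. t * mdist (fst X) x y)"
    and "snd (raw_scale t X) = snd X"
proof -
  interpret M: Metric_space "mspace (fst X)" "mdist (fst X)" by (rule Metric_space_mspace_mdist)
  interpret T: Metric_space "mspace (fst X)" "\<lambda>x y. t * mdist (fst X) x y"
  proof
    show "t * mdist (fst X) x z \<le> t * mdist (fst X) x y + t * mdist (fst X) y z"
      if "x \<in> mspace (fst X)" "y \<in> mspace (fst X)" "z \<in> mspace (fst X)" for x y z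
      using M.triangle[OF that] assms by (simp flip: distrib_left)
  qed (use assms in \<open>auto simp: M.commute\<close>)
  show "mspace (fst (raw_scale t X)) = mspace (fst X)"
    and "mdist (fst (raw_scale t X)) = (\<lambda>x y. t * mdist (fst X) x y)"
    and "snd (raw_scale t X) = snd X"
    using assms T.mspace_metric T.mdist_metric by (simp_all add: raw_scale_def)
qed

lemma raw_scale_topology:
  assumes t: "t > 0"
  shows "mtopology_of (fst (raw_scale t X)) = mtopology_of (fst X)"
proof -
  note s = raw_scale_metric[OF t, of X]
  have "Lipschitz_continuous_map (fst X) (fst (raw_scale t X)) (\<lambda>x. x)"
    unfolding Lipschitz_continuous_map_def s by (auto intro!: exI[of _ t])
  then have 1: "continuous_map (mtopology_of (fst X)) (mtopology_of (fst (raw_scale t X))) (\<lambda>x. x)"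
    by (rule Lipschitz_continuous_imp_continuous_map)
  have "Lipschitz_continuous_map (fst (raw_scale t X)) (fst X) (\<lambda>x. x)"
    unfolding Lipschitz_continuous_map_def s using t by (auto intro!: exI[of _ "1/t"])
  then have 2: "continuous_map (mtopology_of (fst (raw_scale t X))) (mtopology_of (fst X)) (\<lambda>x. x)"
    by (rule Lipschitz_continuous_imp_continuous_map)
  have e: "{x \<in> mspace (fst X). x \<in> U} = U" if "U \<subseteq> mspace (fst X)" for U
    using that by auto
  show ?thesis
    unfolding topology_eq
    using openin_continuous_map_preimage[OF 1] openin_continuous_map_preimage[OF 2]
      openin_subset[of "mtopology_of (fst X)"] openin_subset[of "mtopology_of (fst (raw_scale t X))"]
    by (simp add: s) (metis e)
qed

lemma raw_scale_full:
  assumes X: "full_pm_space X"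
  shows "full_pm_space (raw_scale t X)"
proof (cases "t > 0")
  case t: True
  note s = raw_scale_metric[OF t, of X] raw_scale_topology[OF t, of X]
  interpret M: Metric_space "mspace (fst X)" "mdist (fst X)" by (rule Metric_space_mspace_mdist)
  interpret T: Metric_space "mspace (fst X)" "\<lambda>x y. t * mdist (fst X) x y"
    using Metric_space_mspace_mdist[of "fst (raw_scale t X)"] by (simp add: s)
  have top: "T.mtopology = M.mtopology"
    using s(4) by (simp add: mtopology_of_def s(1,2))
  have "M.MCauchy \<sigma>" if c: "T.MCauchy \<sigma>" for \<sigma>
    unfolding M.MCauchy_def
  proof (intro conjI allI impI)
    show "range \<sigma> \<subseteq> mspace (fst X)" using c by (simp add: T.MCauchy_def)
    fix e :: real assume "e > 0"
    then have "t * e > 0" using t by simp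
    then show "\<exists>N. \<forall>n n'. N \<le> n \<longrightarrow> N \<le> n' \<longrightarrow> mdist (fst X) (\<sigma> n) (\<sigma> n') < e"
      using c t unfolding T.MCauchy_def by (metis mult_less_cancel_left_pos)
  qed
  then have "mcomplete_of (fst (raw_scale t X))" if "mcomplete_of (fst X)"
    using that by (simp add: mcomplete_of_def s(1,2) M.mcomplete_def T.mcomplete_def top)
  then have "pm_space (raw_scale t X)"
    using X by (auto simp: full_pm_space_def pm_space_def case_prod_beta s)
  moreover have "pm_supp (raw_scale t X) = pm_supp X"
    by (simp add: pm_supp_def case_prod_beta s)
  ultimately show ?thesis
    using X by (simp add: full_pm_space_def s)
qed (use X in \<open>simp add: raw_scale_def\<close>)

lemma raw_scale_iso:
  assumes "full_pm_iso X Y"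
  shows "full_pm_iso (raw_scale t X) (raw_scale t Y)"
proof (cases "t > 0")
  case t: True
  have full: "full_pm_space X" "full_pm_space Y" and i: "pm_iso X Y"
    using assms by (auto simp: full_pm_iso_def)
  note s = raw_scale_metric[OF t]
  show ?thesis
  proof (rule full_pm_isometryE[OF full i])
    fix f g
    assume f: "\<And>x. x \<in> mspace (fst X) \<Longrightarrow> f x \<in> mspace (fst Y)"
      "\<And>y. y \<in> mspace (fst Y) \<Longrightarrow> g y \<in> mspace (fst X)"
      "\<And>y. y \<in> mspace (fst Y) \<Longrightarrow> f (g y) = y"
      "\<And>x y. x \<in> mspace (fst X) \<Longrightarrow> y \<in> mspace (fst X) \<Longrightarrow>
         mdist (fst Y) (f x) (f y) = mdist (fst X) x y"
      "distr (snd X) (snd Y) f = snd Y"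
    show ?thesis
      by (rule full_pm_isoI[OF raw_scale_full[OF full(1)] raw_scale_full[OF full(2)], where \<phi> = f])
        (use f in \<open>auto simp: s\<close>)
  qed
qed (use assms in \<open>simp add: raw_scale_def\<close>)


subsection \<open>The space of isomorphism classes\<close>

text \<open>For \<open>'a = real\<close> this is the set of all isomorphism classes of pm-spaces, by
  \<open>full_pm_representative\<close>; for other \<open>'a\<close> it is the part represented by spaces whose carrier is
  a subset of \<open>'a\<close>.\<close>

quotient_type 'a pm_class = "'a metric \<times> 'a measure" / partial: full_pm_iso
  by (rule full_pm_iso_part_equivp)

lift_definition lip_le :: "'a pm_class \<Rightarrow> 'a pm_class \<Rightarrow> bool" (infix "\<prec>" 50) is raw_lip_le
  by (rule iffI; rule raw_lip_le_iso; (assumption | rule full_pm_iso_sym, assumption)?)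

lift_definition box_dist :: "'a pm_class \<Rightarrow> 'a pm_class \<Rightarrow> ennreal" is raw_box
  by (rule antisym; rule raw_box_iso_le; (assumption | rule full_pm_iso_sym, assumption)?)

lift_definition pm_variance :: "'a pm_class \<Rightarrow> ennreal" is raw_variance
  by (rule antisym; rule raw_variance_iso_le; (assumption | rule full_pm_iso_sym, assumption)?)

lift_definition pm_scale :: "real \<Rightarrow> 'a pm_class \<Rightarrow> 'a pm_class" is raw_scale
  by (rule raw_scale_iso)

definition box_topology :: "'a pm_class topology" where
  "box_topology = topology (\<lambda>U. \<forall>X \<in> U. \<exists>\<epsilon>>0. \<forall>Y. box_dist X Y < ennreal \<epsilon> \<longrightarrow> Y \<in> U)"

lemma openin_box_topology:
  "openin box_topology U \<longleftrightarrow> (\<forall>X \<in> U. \<exists>\<epsilon>>0. \<forall>Y. box_dist X Y < ennreal \<epsilon> \<longrightarrow> Y \<in> U)"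
proof -
  have "istopology (\<lambda>U :: 'a pm_class set.
      \<forall>X \<in> U. \<exists>\<epsilon>>0. \<forall>Y. box_dist X Y < ennreal \<epsilon> \<longrightarrow> Y \<in> U)"
    unfolding istopology_def
  proof (intro conjI allI impI ballI)
    fix S T :: "'a pm_class set" and X
    assume S: "\<forall>X \<in> S. \<exists>\<epsilon>>0. \<forall>Y. box_dist X Y < ennreal \<epsilon> \<longrightarrow> Y \<in> S"
      and T: "\<forall>X \<in> T. \<exists>\<epsilon>>0. \<forall>Y. box_dist X Y < ennreal \<epsilon> \<longrightarrow> Y \<in> T"
      and X: "X \<in> S \<inter> T"
    obtain r where r: "r > 0" "\<And>Y. box_dist X Y < ennreal r \<Longrightarrow> Y \<in> S" using S X by blast
    obtain q where q: "q > 0" "\<And>Y. box_dist X Y < ennreal q \<Longrightarrow> Y \<in> T" using T X by blast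
    have "box_dist X Y < ennreal r \<and> box_dist X Y < ennreal q"
      if "box_dist X Y < ennreal (min r q)" for Y
      using that by (auto elim!: less_le_trans intro!: ennreal_leI)
    then show "\<exists>\<epsilon>>0. \<forall>Y. box_dist X Y < ennreal \<epsilon> \<longrightarrow> Y \<in> S \<inter> T"
      using r q by (intro exI[of _ "min r q"]) auto
  next
    fix K :: "'a pm_class set set" and X
    assume K: "\<forall>U \<in> K. \<forall>X \<in> U. \<exists>\<epsilon>>0. \<forall>Y. box_dist X Y < ennreal \<epsilon> \<longrightarrow> Y \<in> U"
      and "X \<in> \<Union>K"
    then obtain U where "U \<in> K" "X \<in> U" by blast
    with K show "\<exists>\<epsilon>>0. \<forall>Y. box_dist X Y < ennreal \<epsilon> \<longrightarrow> Y \<in> \<Union>K" by (meson UnionI)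
  qed
  then show ?thesis by (simp add: box_topology_def)
qed

lemma topspace_box_topology: "topspace box_topology = UNIV"
  by (metis openin_box_topology UNIV_I openin_subset top.extremum_uniqueI zero_less_one)

definition pm_monotone :: "('a pm_class \<Rightarrow> ennreal) \<Rightarrow> bool" where
  "pm_monotone F \<longleftrightarrow> (\<forall>X Y. X \<prec> Y \<longrightarrow> F X \<le> F Y)"

definition lower_semicontinuous :: "'a topology \<Rightarrow> ('a \<Rightarrow> ennreal) \<Rightarrow> bool" where
  "lower_semicontinuous T F \<longleftrightarrow> (\<forall>c. openin T {x \<in> topspace T. c < F x})"

definition pm_homogeneous :: "real \<Rightarrow> ('a pm_class \<Rightarrow> ennreal) \<Rightarrow> bool" where
  "pm_homogeneous d F \<longleftrightarrow> (\<forall>t>0. \<forall>X. F (pm_scale t X) = ennreal (t powr d) * F X)"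

end

theory Submission
  imports Defs
begin

text \<open>Lower semicontinuity: if \<open>V\<^sub>X(f) > c\<close>, truncation of \<open>f\<close> keeps this inequality, so \<open>f\<close> may be
  assumed bounded. A box approximation \<open>(a, b, I)\<close> of \<open>X\<close> by \<open>Y\<close> then carries \<open>f\<close> to the McShane
  extension \<open>g y = inf {f (a s) + d\<^sub>Y (b s, y) | s \<in> I}\<close>, a \<open>1\<close>-Lipschitz function on \<open>Y\<close> with
  \<open>\<bar>g (b s) - f (a s)\<bar> \<le> \<epsilon>\<close> on \<open>I\<close>. Computing both variances on the unit square through the
  parameters gives \<open>V\<^sub>X(f) \<le> V\<^sub>Y(g) + O(\<epsilon>)\<close>.\<close>

section \<open>Change of variables and monotonicity\<close>

text \<open>The square of a pushforward measure is the pushforward of the square under the product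
  map. Needed in two cases: \<open>M\<close> is the measure of a dominating space and
  \<open>\<phi>\<close> a Lipschitz map, or \<open>M\<close> is the unit interval and
  \<open>\<phi>\<close> a parameter.\<close>

lemma fun_variance_pushforward:
  assumes M: "prob_space M" and X: "pm_space X"
    and \<phi> [measurable]: "\<phi> \<in> measurable M (snd X)" and push: "distr M (snd X) \<phi> = snd X"
    and f [measurable]: "f \<in> borel_measurable (snd X)"
  shows "fun_variance X f =
    (\<integral>\<^sup>+ p. ennreal ((f (\<phi> (fst p)) - f (\<phi> (snd p)))\<^sup>2) \<partial>(M \<Otimes>\<^sub>M M)) / 2"
proof -
  interpret X: prob_space "snd X" using X by (auto simp: pm_space_def)
  have "snd X \<Otimes>\<^sub>M snd X = distr (M \<Otimes>\<^sub>M M) (snd X \<Otimes>\<^sub>M snd X) (\<lambda>(x, y). (\<phi> x, \<phi> y))"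
    using pair_measure_distr[OF \<phi> \<phi>] by (simp add: push X.sigma_finite_measure_axioms)
  then have "(\<integral>\<^sup>+ p. ennreal ((f (fst p) - f (snd p))\<^sup>2) \<partial>(snd X \<Otimes>\<^sub>M snd X)) =
      (\<integral>\<^sup>+ p. ennreal ((f (fst p) - f (snd p))\<^sup>2)
        \<partial>(distr (M \<Otimes>\<^sub>M M) (snd X \<Otimes>\<^sub>M snd X) (\<lambda>(x, y). (\<phi> x, \<phi> y))))"
    by simp
  then show ?thesis
    unfolding fun_variance_def by (simp add: nn_integral_distr split_beta')
qed

text \<open>Precomposition with the dominating map \<open>\<phi>\<close> takes \<open>lip1 X\<close>
  into \<open>lip1 Y\<close> and preserves the variance, so the supremum for \<open>Y\<close> runs
  over at least the values occurring for \<open>X\<close>.\<close>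

lemma raw_variance_mono:
  assumes X: "pm_space X" and Y: "pm_space Y" and "raw_lip_le X Y"
  shows "raw_variance X \<le> raw_variance Y"
proof -
  obtain \<phi> where \<phi>: "\<phi> \<in> mspace (fst Y) \<rightarrow> mspace (fst X)"
    "\<And>x y. x \<in> mspace (fst Y) \<Longrightarrow> y \<in> mspace (fst Y) \<Longrightarrow>
       mdist (fst X) (\<phi> x) (\<phi> y) \<le> mdist (fst Y) x y"
    "distr (snd Y) (snd X) \<phi> = snd X"
    using assms(3) by (auto simp: raw_lip_le_def)
  have \<phi>m: "\<phi> \<in> measurable (snd Y) (snd X)" by (rule lip_measurable[OF Y X \<phi>(1,2)])
  have Yp: "prob_space (snd Y)" using Y by (auto simp: pm_space_def)
  show ?thesis
    unfolding raw_variance_def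
  proof (rule SUP_mono)
    fix f assume f: "f \<in> lip1 X"
    have "fun_variance X f = fun_variance Y (f \<circ> \<phi>)"
      using fun_variance_pushforward[OF Yp X \<phi>m \<phi>(3) lip1_measurable[OF X f]]
      by (simp add: fun_variance_def)
    moreover have "f \<circ> \<phi> \<in> lip1 Y"
      unfolding lip1_def
    proof (intro CollectI ballI)
      fix x y assume xy: "x \<in> mspace (fst Y)" "y \<in> mspace (fst Y)"
      then have "\<bar>f (\<phi> x) - f (\<phi> y)\<bar> \<le> mdist (fst X) (\<phi> x) (\<phi> y)"
        using f \<phi>(1) by (auto simp: lip1_def)
      then show "\<bar>(f \<circ> \<phi>) x - (f \<circ> \<phi>) y\<bar> \<le> mdist (fst Y) x y"
        using \<phi>(2)[OF xy] by simp
    qed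
    ultimately show "\<exists>h \<in> lip1 Y. fun_variance X f \<le> fun_variance Y h"
      by (intro bexI[of _ "f \<circ> \<phi>"]) auto
  qed
qed

section \<open>Scaling\<close>

text \<open>Reindexes the supremum for the scaled space by test functions of the original one;
  division by \<open>t\<close> gives the preimage. The variance of each \<open>t * f\<close> then
  contributes the factor \<open>t\<^sup>2\<close>.\<close>

lemma lip1_raw_scale:
  assumes t: "t > 0"
  shows "lip1 (raw_scale t X) = (\<lambda>f x. t * f x) ` lip1 X"
proof (intro equalityI subsetI)
  fix f assume f: "f \<in> lip1 (raw_scale t X)"
  have "(\<lambda>x. f x / t) \<in> lip1 X"
    unfolding lip1_def
  proof (intro CollectI ballI)
    fix x y assume "x \<in> mspace (fst X)" "y \<in> mspace (fst X)"
    then have "\<bar>f x - f y\<bar> \<le> t * mdist (fst X) x y"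
      using f by (auto simp: lip1_def raw_scale_metric[OF t])
    then show "\<bar>f x / t - f y / t\<bar> \<le> mdist (fst X) x y"
      using t by (simp add: diff_divide_distrib[symmetric] abs_divide field_simps)
  qed
  then show "f \<in> (\<lambda>f x. t * f x) ` lip1 X"
    using t by (intro image_eqI[of _ _ "\<lambda>x. f x / t"]) auto
next
  fix f assume "f \<in> (\<lambda>f x. t * f x) ` lip1 X"
  then show "f \<in> lip1 (raw_scale t X)"
    using t by (auto simp: lip1_def raw_scale_metric[OF t] right_diff_distrib[symmetric] abs_mult)
qed

lemma raw_variance_scale:
  assumes X: "pm_space X" and t: "t > 0"
  shows "raw_variance (raw_scale t X) = ennreal (t\<^sup>2) * raw_variance X"
proof -
  have "fun_variance (raw_scale t X) (\<lambda>x. t * f x) = ennreal (t\<^sup>2) * fun_variance X f"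
    if "f \<in> lip1 X" for f
  proof -
    have [measurable]: "f \<in> borel_measurable (snd X)" by (rule lip1_measurable[OF X that])
    have "(t * a - t * b)\<^sup>2 = t\<^sup>2 * (a - b)\<^sup>2" for a b :: real
      by (simp add: right_diff_distrib[symmetric] power_mult_distrib)
    then show ?thesis
      by (simp add: fun_variance_def raw_scale_metric[OF t] ennreal_mult nn_integral_cmult
          ennreal_times_divide)
  qed
  then show ?thesis
    unfolding raw_variance_def lip1_raw_scale[OF t] image_image SUP_mult_left_ennreal
    by (intro SUP_cong) auto
qed

section \<open>Truncation to bounded test functions\<close>

lemma abs_clamp_diff_le:
  fixes x y :: real
  shows "\<bar>max (- r) (min r x) - max (- r) (min r y)\<bar> \<le> \<bar>x - y\<bar>"
  by linarith

text \<open>The error in the box estimate depends on a bound for the test function. The squared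
  differences of the truncations \<open>h n\<close> increase to those of \<open>f\<close>, so by
  monotone convergence their variances have supremum \<open>fun_variance X f\<close>, and one of
  them already exceeds \<open>c\<close>.\<close>

lemma bounded_lip1_variance:
  assumes X: "pm_space X" and c: "c < raw_variance X"
  obtains f r where "f \<in> lip1 X" "r \<ge> 0" "\<And>x. \<bar>f x\<bar> \<le> r" "c < fun_variance X f"
proof -
  obtain f where f: "f \<in> lip1 X" and cf: "c < fun_variance X f"
    using c by (auto simp: raw_variance_def less_SUP_iff)
  have [measurable]: "f \<in> borel_measurable (snd X)" by (rule lip1_measurable[OF X f])
  define h where "h n x = max (- real n) (min (real n) (f x))" for n x
  have [measurable]: "h n \<in> borel_measurable (snd X)" for n
    unfolding h_def by measurable
  define G where "G n p = ennreal ((h n (fst p) - h n (snd p))\<^sup>2)" for n p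
  have [measurable]: "G n \<in> borel_measurable (snd X \<Otimes>\<^sub>M snd X)" for n
    unfolding G_def by measurable
  have hl: "h n \<in> lip1 X" for n
    unfolding lip1_def h_def
  proof (intro CollectI ballI)
    fix x y assume "x \<in> mspace (fst X)" "y \<in> mspace (fst X)"
    then have "\<bar>f x - f y\<bar> \<le> mdist (fst X) x y" using f by (auto simp: lip1_def)
    then show "\<bar>max (- real n) (min (real n) (f x)) - max (- real n) (min (real n) (f y))\<bar>
        \<le> mdist (fst X) x y"
      using abs_clamp_diff_le[of "real n" "f x" "f y"] by linarith
  qed
  \<comment> \<open>\<open>h n\<close> is \<open>h (Suc n)\<close> clamped once more, and clamping
    never enlarges a difference.\<close>
  have inc: "incseq (\<lambda>n. G n p)" for p
  proof (rule incseq_SucI)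
    fix n
    have "\<bar>h n (fst p) - h n (snd p)\<bar> \<le> \<bar>h (Suc n) (fst p) - h (Suc n) (snd p)\<bar>"
      unfolding h_def by (auto simp: max_def min_def)
    then show "G n p \<le> G (Suc n) p" by (simp add: G_def abs_le_square_iff)
  qed
  then have "incseq G" by (simp add: incseq_def le_fun_def)
  have sup: "(SUP n. G n p) = ennreal ((f (fst p) - f (snd p))\<^sup>2)" for p
  proof (rule LIMSEQ_unique)
    show "(\<lambda>n. G n p) \<longlonglongrightarrow> (SUP n. G n p)"
      by (rule LIMSEQ_SUP[OF inc])
    obtain N where N: "\<bar>f (fst p)\<bar> + \<bar>f (snd p)\<bar> \<le> real N" using real_arch_simple by blast
    have "G n p = ennreal ((f (fst p) - f (snd p))\<^sup>2)" if "n \<ge> N" for n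
    proof -
      have "\<bar>f (fst p)\<bar> + \<bar>f (snd p)\<bar> \<le> real n" using N that by linarith
      then have "h n (fst p) = f (fst p)" "h n (snd p) = f (snd p)" by (auto simp: h_def)
      then show ?thesis by (simp add: G_def)
    qed
    then show "(\<lambda>n. G n p) \<longlonglongrightarrow> ennreal ((f (fst p) - f (snd p))\<^sup>2)"
      by (intro tendsto_eventually) (auto simp: eventually_sequentially)
  qed
  have "fun_variance X f = (SUP n. integral\<^sup>N (snd X \<Otimes>\<^sub>M snd X) (G n)) / 2"
    unfolding fun_variance_def
    using nn_integral_monotone_convergence_SUP[OF \<open>incseq G\<close>, of "snd X \<Otimes>\<^sub>M snd X"]
    by (simp add: sup)
  also have "\<dots> = (SUP n. fun_variance X (h n))"
    by (simp add: fun_variance_def G_def[abs_def] SUP_divide_ennreal)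
  finally obtain n where "c < fun_variance X (h n)"
    using cf by (auto simp: less_SUP_iff)
  moreover have "\<bar>h n x\<bar> \<le> real n" for x by (auto simp: h_def)
  ultimately show thesis using hl by (intro that[of "h n" "real n"]) auto
qed

section \<open>Transfer of a test function across a box approximation\<close>

lemma prob_space_unit_interval: "prob_space unit_interval_measure"
  unfolding unit_interval_measure_def
  by (rule prob_spaceI) (simp add: space_restrict_space emeasure_restrict_space)

text \<open>The data \<open>u\<close> is indexed by parameter values, since \<open>b\<close> may
  identify parameters at which \<open>u\<close> differs; \<open>lip\<close> limits such a
  discrepancy to \<open>\<epsilon>\<close>. Extending to all of \<open>Y\<close> yields a Lipschitz,
  hence measurable, function whatever the image of \<open>I\<close> under \<open>b\<close> looks
  like.\<close>

lemma mcshane_extension: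
  assumes Y: "pm_space Y" and I: "I \<noteq> {}"
    and b: "\<And>s. s \<in> I \<Longrightarrow> b s \<in> mspace (fst Y)"
    and bdd: "\<And>s. s \<in> I \<Longrightarrow> - r \<le> u s"
    and lip: "\<And>s t. s \<in> I \<Longrightarrow> t \<in> I \<Longrightarrow> u t - u s \<le> mdist (fst Y) (b s) (b t) + \<epsilon>"
  obtains g where "g \<in> lip1 Y" "\<And>t. t \<in> I \<Longrightarrow> g (b t) \<le> u t" "\<And>t. t \<in> I \<Longrightarrow> u t - \<epsilon> \<le> g (b t)"
proof -
  interpret M: Metric_space "mspace (fst Y)" "mdist (fst Y)" by (rule Metric_space_mspace_mdist)
  define g where "g y = (INF s\<in>I. u s + mdist (fst Y) (b s) y)" for y
  \<comment> \<open>A real infimum is controlled by its terms only if the family is bounded below;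
    this is where the lower bound on \<open>u\<close> enters.\<close>
  have bb: "bdd_below ((\<lambda>s. u s + mdist (fst Y) (b s) y) ` I)" for y
    using bdd by (intro bdd_belowI2[where m = "- r"]) (simp add: add_increasing2)
  have le: "g x - g y \<le> mdist (fst Y) x y" if "x \<in> mspace (fst Y)" "y \<in> mspace (fst Y)" for x y
  proof -
    have "g x - mdist (fst Y) x y \<le> g y"
      unfolding g_def[of y]
    proof (rule cINF_greatest[OF I])
      fix s assume s: "s \<in> I"
      have "g x \<le> u s + mdist (fst Y) (b s) x"
        unfolding g_def by (rule cINF_lower[OF bb s])
      also have "mdist (fst Y) (b s) x \<le> mdist (fst Y) (b s) y + mdist (fst Y) y x"
        using that b[OF s] by (intro M.triangle)
      finally show "g x - mdist (fst Y) x y \<le> u s + mdist (fst Y) (b s) y"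
        by (simp add: M.commute)
    qed
    then show ?thesis by simp
  qed
  show thesis
  proof
    show "g \<in> lip1 Y"
      unfolding lip1_def using le by (auto simp: abs_le_iff) (metis M.commute)
    fix t assume t: "t \<in> I"
    \<comment> \<open>The term \<open>s = t\<close> of the infimum gives the upper bound; the lower
      bound holds termwise by \<open>lip\<close>.\<close>
    have "g (b t) \<le> u t + mdist (fst Y) (b t) (b t)"
      unfolding g_def by (rule cINF_lower[OF bb t])
    then show "g (b t) \<le> u t" using b[OF t] by simp
    show "u t - \<epsilon> \<le> g (b t)"
      unfolding g_def
    proof (rule cINF_greatest[OF I])
      fix s assume "s \<in> I"
      then show "u t - \<epsilon> \<le> u s + mdist (fst Y) (b s) (b t)" using lip[OF _ t, of s] by simp
    qed
  qed
qed

text \<open>Write \<open>p' - q'\<close> as \<open>D + e\<close> with \<open>D = p - q\<close>. Both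
  values move down by at most \<open>\<epsilon>\<close>, so the shifts partly cancel and
  \<open>\<bar>e\<bar> \<le> \<epsilon>\<close>, not merely \<open>2 * \<epsilon>\<close>. Dropping
  \<open>e\<^sup>2\<close> from the expanded square leaves the cross term, at least
  \<open>- 4 * r * \<epsilon>\<close>.\<close>

lemma diff_square_le_near:
  fixes p q p' q' :: real
  assumes "\<bar>p\<bar> \<le> r" "\<bar>q\<bar> \<le> r" "0 \<le> \<epsilon>" "p - \<epsilon> \<le> p'" "p' \<le> p" "q - \<epsilon> \<le> q'" "q' \<le> q"
  shows "(p - q)\<^sup>2 \<le> (p' - q')\<^sup>2 + 4 * r * \<epsilon>"
proof -
  define D where "D = p - q"
  define e where "e = (p' - q') - D"
  have "\<bar>D\<bar> \<le> 2 * r" "\<bar>e\<bar> \<le> \<epsilon>" using assms by (auto simp: D_def e_def)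
  then have "\<bar>D\<bar> * \<bar>e\<bar> \<le> (2 * r) * \<epsilon>" by (intro mult_mono) auto
  then have "- (2 * r * \<epsilon>) \<le> D * e" by (simp add: abs_mult[symmetric] abs_le_iff)
  moreover have "(p' - q')\<^sup>2 = D\<^sup>2 + 2 * (D * e) + e\<^sup>2"
    by (simp add: e_def power2_eq_square algebra_simps)
  ultimately show ?thesis using zero_le_power2[of e] unfolding D_def[symmetric] by linarith
qed

text \<open>On \<open>I \<times> I\<close> the squared differences of \<open>f\<close> exceed those
  of \<open>g\<close> by at most \<open>4 * r * \<epsilon>\<close>. The rest of the unit square lies
  in two strips of measure at most \<open>\<epsilon>\<close>, where the integrand is at most
  \<open>4 * r\<^sup>2\<close>. Half of the total error is the stated bound.\<close>

lemma fun_variance_le_box_approx: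
  assumes X: "pm_space X" and Y: "pm_space Y"
    and f: "f \<in> lip1 X" and r: "\<And>x. \<bar>f x\<bar> \<le> r"
    and \<epsilon>: "0 < \<epsilon>" "\<epsilon> < 1"
    and a: "a \<in> pm_parameters X" and b: "b \<in> pm_parameters Y"
    and I: "I \<in> sets borel" "I \<subseteq> {0..1}" "1 - \<epsilon> \<le> measure lborel I"
    and d: "\<And>s t. s \<in> I \<Longrightarrow> t \<in> I \<Longrightarrow>
              \<bar>mdist (fst X) (a s) (a t) - mdist (fst Y) (b s) (b t)\<bar> \<le> \<epsilon>"
  shows "fun_variance X f \<le> raw_variance Y + ennreal ((2 * r + 4 * r\<^sup>2) * \<epsilon>)"
proof -
  let ?U = unit_interval_measure
  let ?J = "{0..1} - I"
  interpret U: prob_space ?U by (rule prob_space_unit_interval)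
  interpret UU: pair_prob_space ?U ?U ..
  have am [measurable]: "a \<in> measurable ?U (snd X)" and ad: "distr ?U (snd X) a = snd X"
    and bm [measurable]: "b \<in> measurable ?U (snd Y)" and bd: "distr ?U (snd Y) b = snd Y"
    using a b by (auto simp: pm_parameters_def)
  have sp: "space ?U = {0..1}" by (simp add: unit_interval_measure_def space_restrict_space)
  have as: "a s \<in> mspace (fst X)" "b s \<in> mspace (fst Y)" if "s \<in> I" for s
    using measurable_space[OF am, of s] measurable_space[OF bm, of s] that I(2)
    by (auto simp: sp space_pm[OF X] space_pm[OF Y])
  \<comment> \<open>Since \<open>\<epsilon> < 1\<close>, the set \<open>I\<close> has positive
    measure; an infimum over it needs a member.\<close>
  have "I \<noteq> {}" using I(3) \<epsilon> by auto
  then obtain g where g: "g \<in> lip1 Y" "\<And>t. t \<in> I \<Longrightarrow> g (b t) \<le> f (a t)"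
    "\<And>t. t \<in> I \<Longrightarrow> f (a t) - \<epsilon> \<le> g (b t)"
  proof (rule mcshane_extension[OF Y, where b = b and u = "\<lambda>s. f (a s)" and r = r and \<epsilon> = \<epsilon>])
    show "- r \<le> f (a s)" for s using r[of "a s"] by linarith
    show "f (a t) - f (a s) \<le> mdist (fst Y) (b s) (b t) + \<epsilon>" if "s \<in> I" "t \<in> I" for s t
    proof -
      have "\<bar>f (a s) - f (a t)\<bar> \<le> mdist (fst X) (a s) (a t)"
        using f as that by (auto simp: lip1_def)
      then show ?thesis using d[OF that] by linarith
    qed
  qed (auto intro: as)
  have fm [measurable]: "f \<in> borel_measurable (snd X)" by (rule lip1_measurable[OF X f])
  have gm [measurable]: "g \<in> borel_measurable (snd Y)" by (rule lip1_measurable[OF Y g(1)])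
  have r0: "0 \<le> r" using r[of undefined] by linarith
  have Is: "I \<in> sets ?U" using I by (auto simp: unit_interval_measure_def sets_restrict_space)
  then have J [measurable]: "?J \<in> sets ?U" using sets.compl_sets[OF Is] by (simp add: sp)
  have eJ: "emeasure ?U ?J \<le> ennreal \<epsilon>"
  proof -
    have "U.prob I = measure lborel I"
      unfolding unit_interval_measure_def using I by (intro measure_restrict_space) auto
    then have "U.prob ?J \<le> \<epsilon>" using U.prob_compl[OF Is] I(3) by (simp add: sp)
    then show ?thesis by (simp add: U.emeasure_eq_measure ennreal_leI)
  qed
  define F where "F p = ennreal ((f (a (fst p)) - f (a (snd p)))\<^sup>2)" for p
  define G where "G p = ennreal ((g (b (fst p)) - g (b (snd p)))\<^sup>2)" for p
  have [measurable]: "G \<in> borel_measurable (?U \<Otimes>\<^sub>M ?U)" unfolding G_def by measurable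
  \<comment> \<open>One majorant serves both cases because all its terms are nonnegative. The two
    strips overlap in \<open>?J \<times> ?J\<close>, which is counted twice at no harm to the upper
    bound.\<close>
  have "(\<integral>\<^sup>+p. F p \<partial>(?U \<Otimes>\<^sub>M ?U)) \<le>
      (\<integral>\<^sup>+p. G p + (ennreal (4 * r * \<epsilon>) + (ennreal (4 * r\<^sup>2) * indicator (?J \<times> space ?U) p
         + ennreal (4 * r\<^sup>2) * indicator (space ?U \<times> ?J) p)) \<partial>(?U \<Otimes>\<^sub>M ?U))"
  proof (rule nn_integral_mono)
    fix p assume "p \<in> space (?U \<Otimes>\<^sub>M ?U)"
    then obtain s t where p: "p = (s, t)" "s \<in> {0..1}" "t \<in> {0..1}"
      by (auto simp: space_pair_measure sp)
    show "F p \<le> G p + (ennreal (4 * r * \<epsilon>) + (ennreal (4 * r\<^sup>2) * indicator (?J \<times> space ?U) p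
         + ennreal (4 * r\<^sup>2) * indicator (space ?U \<times> ?J) p))"
    proof (cases "s \<in> I \<and> t \<in> I")
      case True
      then have "(f (a s) - f (a t))\<^sup>2 \<le> (g (b s) - g (b t))\<^sup>2 + 4 * r * \<epsilon>"
        using g \<epsilon> r by (intro diff_square_le_near) auto
      then have "F p \<le> G p + ennreal (4 * r * \<epsilon>)"
        using r0 \<epsilon> by (simp add: F_def G_def p ennreal_plus[symmetric] ennreal_leI del: ennreal_plus)
      then show ?thesis by (simp add: add.assoc[symmetric] add_increasing2)
    next
      case False
      have "\<bar>f (a s) - f (a t)\<bar> \<le> \<bar>2 * r\<bar>" using r[of "a s"] r[of "a t"] by linarith
      then have "(f (a s) - f (a t))\<^sup>2 \<le> 4 * r\<^sup>2"
        by (simp add: abs_le_square_iff power_mult_distrib)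
      then have *: "F p \<le> ennreal (4 * r\<^sup>2)" by (simp add: F_def p ennreal_leI)
      also have "\<dots> \<le> ennreal (4 * r\<^sup>2) * indicator (?J \<times> space ?U) p
         + ennreal (4 * r\<^sup>2) * indicator (space ?U \<times> ?J) p"
        using False p by (auto simp: sp indicator_def)
      finally show ?thesis by (simp add: add_increasing)
    qed
  qed
  also have "\<dots> = (\<integral>\<^sup>+p. G p \<partial>(?U \<Otimes>\<^sub>M ?U)) + (ennreal (4 * r * \<epsilon>)
      + (ennreal (4 * r\<^sup>2) * emeasure ?U ?J + ennreal (4 * r\<^sup>2) * emeasure ?U ?J))"
    by (simp add: nn_integral_add nn_integral_cmult U.emeasure_pair_measure_Times
        U.emeasure_space_1 UU.P.emeasure_space_1)
  also have "\<dots> \<le> (\<integral>\<^sup>+p. G p \<partial>(?U \<Otimes>\<^sub>M ?U)) + (ennreal (4 * r * \<epsilon>)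
      + (ennreal (4 * r\<^sup>2) * ennreal \<epsilon> + ennreal (4 * r\<^sup>2) * ennreal \<epsilon>))"
    using eJ by (intro add_mono mult_left_mono order_refl) auto
  \<comment> \<open>The error is written as a double so that it cancels the factor one half of the
    variance.\<close>
  also have "ennreal (4 * r * \<epsilon>) + (ennreal (4 * r\<^sup>2) * ennreal \<epsilon> + ennreal (4 * r\<^sup>2) * ennreal \<epsilon>)
      = ennreal (2 * ((2 * r + 4 * r\<^sup>2) * \<epsilon>))"
    using r0 \<epsilon> by (simp add: ennreal_mult[symmetric] ennreal_plus[symmetric] algebra_simps
        del: ennreal_plus)
  also have "\<dots> = 2 * ennreal ((2 * r + 4 * r\<^sup>2) * \<epsilon>)"
    using r0 \<epsilon> by (subst ennreal_mult) auto
  finally have "(\<integral>\<^sup>+p. F p \<partial>(?U \<Otimes>\<^sub>M ?U)) / 2 \<le>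
      ((\<integral>\<^sup>+p. G p \<partial>(?U \<Otimes>\<^sub>M ?U)) + 2 * ennreal ((2 * r + 4 * r\<^sup>2) * \<epsilon>)) / 2"
    by (rule divide_right_mono_ennreal)
  also have "\<dots> = (\<integral>\<^sup>+p. G p \<partial>(?U \<Otimes>\<^sub>M ?U)) / 2 + ennreal ((2 * r + 4 * r\<^sup>2) * \<epsilon>)"
    by (simp add: add_divide_distrib_ennreal ennreal_mult_divide_eq mult.commute[of 2])
  finally have "fun_variance X f \<le> fun_variance Y g + ennreal ((2 * r + 4 * r\<^sup>2) * \<epsilon>)"
    using fun_variance_pushforward[OF U.prob_space_axioms X am ad fm]
      fun_variance_pushforward[OF U.prob_space_axioms Y bm bd gm]
    by (simp add: F_def G_def)
  also have "fun_variance Y g \<le> raw_variance Y"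
    unfolding raw_variance_def by (rule SUP_upper[OF g(1)])
  finally show ?thesis by (simp add: add_right_mono)
qed

section \<open>Lower semicontinuity on representatives\<close>

lemma raw_variance_lower_semicontinuous:
  assumes X: "pm_space X" and c: "c < raw_variance X"
  shows "\<exists>\<epsilon>>0. \<forall>Y. pm_space Y \<longrightarrow> raw_box X Y < ennreal \<epsilon> \<longrightarrow> c < raw_variance Y"
proof -
  obtain f r where f: "f \<in> lip1 X" "r \<ge> 0" "\<And>x. \<bar>f x\<bar> \<le> r" and cf: "c < fun_variance X f"
    by (rule bounded_lip1_variance[OF X c]) blast
  \<comment> \<open>Both \<open>c\<close> and \<open>e\<close> lie strictly below another value, so
    they are finite, and \<open>e' - c'\<close> is a positive real margin for the error.\<close>
  obtain e where e: "c < e" "e < fun_variance X f" using dense[OF cf] by blast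
  then obtain c' e' where ce: "c = ennreal c'" "e = ennreal e'" "0 \<le> c'" "c' < e'"
    by (cases c; cases e) (auto simp: ennreal_less_iff)
  define K where "K = 2 * r + 4 * r\<^sup>2"
  have K: "K \<ge> 0" using f(2) by (simp add: K_def)
  \<comment> \<open>The bound \<open>1\<close> secures \<open>\<epsilon> < 1\<close> for the box
    estimate; the other keeps the error \<open>K * \<epsilon>\<close> within the margin. Dividing by
    \<open>K + 1\<close> covers \<open>K = 0\<close>.\<close>
  define \<delta> where "\<delta> = min 1 ((e' - c') / (K + 1))"
  have \<delta>: "\<delta> > 0" "\<delta> \<le> 1" using K ce by (auto simp: \<delta>_def)
  have "K * \<delta> \<le> (K + 1) * ((e' - c') / (K + 1))"
    using K \<delta> by (intro mult_mono) (auto simp: \<delta>_def)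
  then have K\<delta>: "K * \<delta> \<le> e' - c'" using K by simp
  show ?thesis
  proof (intro exI[of _ \<delta>] conjI allI impI)
    fix Y assume Y: "pm_space Y" and "raw_box X Y < ennreal \<delta>"
    then obtain \<epsilon> a b I where h: "0 < \<epsilon>" "ennreal \<epsilon> < ennreal \<delta>"
      "a \<in> pm_parameters X" "b \<in> pm_parameters Y" "I \<in> sets borel" "I \<subseteq> {0..1}"
      "1 - \<epsilon> \<le> measure lborel I"
      "\<And>s t. s \<in> I \<Longrightarrow> t \<in> I \<Longrightarrow> \<bar>mdist (fst X) (a s) (a t) - mdist (fst Y) (b s) (b t)\<bar> \<le> \<epsilon>"
      unfolding raw_box_def Inf_less_iff by blast
    then have \<epsilon>: "\<epsilon> < \<delta>" "\<epsilon> < 1" using \<delta> by (auto simp: ennreal_less_iff)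
    have "fun_variance X f \<le> raw_variance Y + ennreal (K * \<epsilon>)"
      unfolding K_def by (rule fun_variance_le_box_approx[OF X Y f(1,3) h(1) \<epsilon>(2) h(3-8)])
    also have "\<dots> \<le> raw_variance Y + ennreal (e' - c')"
      using K K\<delta> \<epsilon> by (intro add_left_mono ennreal_leI)
        (metis less_imp_le mult_left_mono order_trans)
    finally have "ennreal e' < raw_variance Y + ennreal (e' - c')" using e ce by simp
    \<comment> \<open>\<open>raw_variance Y\<close> may be infinite, so the margin is not
      subtracted: \<open>raw_variance Y \<le> c\<close> would contradict the strict inequality just
      obtained.\<close>
    moreover have "raw_variance Y + ennreal (e' - c') \<le> ennreal e'" if "raw_variance Y \<le> c"
      using add_right_mono[OF that, of "ennreal (e' - c')"] ce
      by (simp add: ennreal_plus[symmetric] del: ennreal_plus)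
    ultimately show "c < raw_variance Y" using not_le by blast
  qed (rule \<delta>)
qed

section \<open>Passage to isomorphism classes\<close>

text \<open>\<open>transfer\<close> turns classes into representatives \<open>X\<close> with
  \<open>full_pm_iso X X\<close>, which entails \<open>pm_space X\<close>; the results on
  representatives then apply.\<close>

lemma pm_variance_monotone: "pm_monotone pm_variance"
  unfolding pm_monotone_def
  by transfer (auto intro!: raw_variance_mono simp: full_pm_iso_def full_pm_space_def)

lemma pm_variance_lower_semicontinuous:
  "lower_semicontinuous box_topology (pm_variance :: 'a pm_class \<Rightarrow> ennreal)"
proof -
  \<comment> \<open>Openness of the superlevel sets, spelled out with balls as in
    \<open>openin_box_topology\<close>; in this form it transfers to representatives.\<close>
  have "\<forall>X :: 'a pm_class. c < pm_variance X \<longrightarrow>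
      (\<exists>\<epsilon>>0. \<forall>Y. box_dist X Y < ennreal \<epsilon> \<longrightarrow> c < pm_variance Y)" for c
  proof (transfer, intro ballI impI)
    fix c and X :: "'a pm"
    assume "X \<in> {X. full_pm_iso X X}" "c < raw_variance X"
    then show "\<exists>\<epsilon>>0. \<forall>Y\<in>{Y. full_pm_iso Y Y}. raw_box X Y < ennreal \<epsilon> \<longrightarrow> c < raw_variance Y"
      using raw_variance_lower_semicontinuous[of X c]
      by (force simp: full_pm_iso_def full_pm_space_def)
  qed
  then show ?thesis
    by (simp add: lower_semicontinuous_def openin_box_topology topspace_box_topology)
qed

lemma pm_variance_homogeneous: "pm_homogeneous 2 pm_variance"
  unfolding pm_homogeneous_def
  by transfer (auto simp: raw_variance_scale full_pm_iso_def full_pm_space_def)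

theorem proposition4p2:
  shows "pm_monotone (pm_variance :: 'a pm_class \<Rightarrow> ennreal) \<and>
         lower_semicontinuous box_topology (pm_variance :: 'a pm_class \<Rightarrow> ennreal) \<and>
         pm_homogeneous 2 (pm_variance :: 'a pm_class \<Rightarrow> ennreal)"
  using pm_variance_monotone pm_variance_lower_semicontinuous pm_variance_homogeneous by blast

end
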